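(* Let $(F,\le)$ be an ordered field, $n$ a positive integer, and let $A,B\in M_{\ast,n}(F)$ be row echelon forms. If $v_n(A)=v_n(B)$ (i.e. $A\sim_n B$), then $\operatorname{shape}(A)=\operatorname{shape}(B)$ and, for each $i$, the natural valuation (in $F$) of the $i$-th pivot of $A$ is equal to the natural valuation of the $i$-th pivot of $B$.
   Context: $M_{\ast,n}(F)=\bigcup_{m\ge 1}M_{m,n}(F)$ is the set of all matrices over $F$ with $n$ columns. For symmetric $S,T\in M_n(F)$ write $S\le_n T$ iff $T-S$ is positive semidefinite, i.e. $v^T(T-S)v\ge 0$ for all $v\in F^n$. For $A,B\in M_{\ast,n}(F)$ write $A\succeq_n B$ iff there is $r\in\mathbb N$ with $A^TA\le_n rB^TB$, and $A\sim_n B$ iff $A\succeq_n B$ and $B\succeq_n A$; $v_n(A)$ denotes the $\sim_n$-class of $A$. A matrix is a row echelon form if all its zero rows are at the bottom and, for each $i$, the first nonzero element of the $(i+1)$-th nonzero row lies strictly to the right of the first nonzero element of the $i$-th nonzero row; the first nonzero element of the $i$-th nonzero row is the $i$-th pivot. For a row echelon form $C\in M_{k,n}(F)$, $\operatorname{shape}(C)=\{(i,j)\in\{1,\dots,k\}\times\{1,\dots,n\}\mid \exists j_0\le j:\ c_{ij_0}\ne 0\}$. Natural valuation $v$ of $F$: for $a,b\in F$ write $a\succeq b$ iff $|a|\le r|b|$ for some $r\in\mathbb N$, and $a\sim b$ iff $a\succeq b$ and $b\succeq a$; $v(a)$ is the $\sim$-class of $a$. *)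

theory Defs
  imports "Jordan_Normal_Form.Matrix"
begin

text \<open>
  An ordered field is a type of class \<^class>\<open>linordered_field\<close>. Rows and columns are
  numbered from 0, as in \<^typ>\<open>'a mat\<close>.
\<close>

definition mats :: "nat \<Rightarrow> 'a mat set" where
  "mats n = (\<Union>m\<in>{1..}. carrier_mat m n)"

definition psd :: "nat \<Rightarrow> 'a :: linordered_field mat \<Rightarrow> bool" where
  "psd n S \<longleftrightarrow> (\<forall>v \<in> carrier_vec n. v \<bullet> (S *\<^sub>v v) \<ge> 0)"

text \<open>The next relation is meant for symmetric \<open>n \<times> n\<close> matrices; below it only compares
  multiples of matrices of the form \<open>A\<^sup>T A\<close>.\<close>

definition psd_le :: "nat \<Rightarrow> 'a :: linordered_field mat \<Rightarrow> 'a mat \<Rightarrow> bool" where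
  "psd_le n S T \<longleftrightarrow> psd n (T - S)"

definition mat_succeq :: "nat \<Rightarrow> 'a :: linordered_field mat \<Rightarrow> 'a mat \<Rightarrow> bool" where
  "mat_succeq n A B \<longleftrightarrow>
     (\<exists>r :: nat. psd_le n (transpose_mat A * A) (of_nat r \<cdot>\<^sub>m (transpose_mat B * B)))"

definition mat_sim :: "nat \<Rightarrow> 'a :: linordered_field mat \<Rightarrow> 'a mat \<Rightarrow> bool" where
  "mat_sim n A B \<longleftrightarrow> mat_succeq n A B \<and> mat_succeq n B A"

definition mat_val :: "nat \<Rightarrow> 'a :: linordered_field mat \<Rightarrow> 'a mat set" where
  "mat_val n A = {B \<in> mats n. mat_sim n A B}"

definition nat_succeq :: "'a :: linordered_field \<Rightarrow> 'a \<Rightarrow> bool" where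
  "nat_succeq a b \<longleftrightarrow> (\<exists>r :: nat. \<bar>a\<bar> \<le> of_nat r * \<bar>b\<bar>)"

definition nat_sim :: "'a :: linordered_field \<Rightarrow> 'a \<Rightarrow> bool" where
  "nat_sim a b \<longleftrightarrow> nat_succeq a b \<and> nat_succeq b a"

definition natural_val :: "'a :: linordered_field \<Rightarrow> 'a set" where
  "natural_val a = {b. nat_sim a b}"

definition nonzero_row :: "'a :: zero mat \<Rightarrow> nat \<Rightarrow> bool" where
  "nonzero_row C i \<longleftrightarrow> i < dim_row C \<and> (\<exists>j < dim_col C. C $$ (i, j) \<noteq> 0)"

definition pivot_col :: "'a :: zero mat \<Rightarrow> nat \<Rightarrow> nat" where
  "pivot_col C i = (LEAST j. j < dim_col C \<and> C $$ (i, j) \<noteq> 0)"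

text \<open>Both this and \<open>pivot_col\<close> are meaningful only if row \<open>i\<close> is nonzero. In a row
  echelon form the \<open>i\<close>-th nonzero row is row \<open>i\<close> of the matrix.\<close>

definition pivot :: "'a :: zero mat \<Rightarrow> nat \<Rightarrow> 'a" where
  "pivot C i = C $$ (i, pivot_col C i)"

text \<open>Unlike \<open>row_echelon_form\<close> in Jordan_Normal_Form, pivots need not be 1 and the entries
  above a pivot need not vanish.\<close>

definition echelon_form :: "'a :: zero mat \<Rightarrow> bool" where
  "echelon_form C \<longleftrightarrow>
     (\<forall>i i'. i < i' \<and> nonzero_row C i' \<longrightarrow> nonzero_row C i) \<and>
     (\<forall>i. nonzero_row C i \<and> nonzero_row C (Suc i) \<longrightarrow> pivot_col C i < pivot_col C (Suc i))"

definition shape :: "'a :: zero mat \<Rightarrow> (nat \<times> nat) set" where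
  "shape C = {(i, j). i < dim_row C \<and> j < dim_col C \<and> (\<exists>j0 \<le> j. C $$ (i, j0) \<noteq> 0)}"

end

theory Submission
  imports Defs
begin

text \<open>
  The relation \<open>A \<succeq>\<^sub>n B\<close> says that \<open>\<parallel>A v\<parallel>\<^sup>2 \<le> r \<parallel>B v\<parallel>\<^sup>2\<close> for all \<open>v\<close> and a fixed natural
  number \<open>r\<close>. The pivots of an echelon form \<open>C\<close> can be read off from the function
  \<open>v \<mapsto> \<parallel>C v\<parallel>\<^sup>2\<close>: among the vectors \<open>v\<close> whose last nonzero entry is a 1 in column \<open>j\<close>,
  the minimum of \<open>\<parallel>C v\<parallel>\<^sup>2\<close> is the square of the pivot in column \<open>j\<close>, or 0 if column \<open>j\<close>
  contains no pivot. Indeed, a row with pivot \<open>p\<close> in column \<open>j\<close> maps every such \<open>v\<close> to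
  \<open>p\<close> (\<open>column_pivot_sq_le\<close>), and back substitution along the pivots to the left of column
  \<open>j\<close> makes all the other entries of \<open>C v\<close> vanish (\<open>column_pivot_sq_attained\<close>).

  Hence \<open>A \<succeq>\<^sub>n B\<close> bounds these minima for \<open>A\<close> by \<open>r\<close> times those for \<open>B\<close>. If also
  \<open>B \<succeq>\<^sub>n A\<close>, then both minima vanish for the same columns, so \<open>A\<close> and \<open>B\<close> have the same
  pivot columns. As pivot columns increase with the row, this fixes the pivot column of each
  row, and so the shape; and in each pivot column the two pivots bound each other
  up to natural factors.
\<close>

section \<open>The quadratic form of a Gram matrix\<close>

lemma gram_quadratic_form:
  fixes A :: "'a :: linordered_field mat"
  assumes A: "A \<in> carrier_mat m n" and v: "v \<in> carrier_vec n"
  shows "v \<bullet> ((transpose_mat A * A) *\<^sub>v v) = (A *\<^sub>v v) \<bullet> (A *\<^sub>v v)"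
proof -
  have "v \<bullet> ((transpose_mat A * A) *\<^sub>v v) = v \<bullet> (transpose_mat A *\<^sub>v (A *\<^sub>v v))"
    using A v by (simp add: assoc_mult_mat_vec[of _ n m _ n])
  also have "\<dots> = (transpose_mat A *\<^sub>v (A *\<^sub>v v)) \<bullet> v"
    using A v by (intro comm_scalar_prod[of _ n]) auto
  also have "\<dots> = (A *\<^sub>v v) \<bullet> (A *\<^sub>v v)"
    using A v by (intro transpose_vec_mult_scalar[of _ m n]) auto
  finally show ?thesis .
qed

lemma smult_mat_mult_vec:
  fixes A :: "'a :: comm_semiring_0 mat"
  assumes "v \<in> carrier_vec (dim_col A)"
  shows "(a \<cdot>\<^sub>m A) *\<^sub>v v = a \<cdot>\<^sub>v (A *\<^sub>v v)"
  using assms by (intro eq_vecI) auto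

lemma mult_mat_unit_vec:
  fixes A :: "'a :: semiring_1 mat"
  assumes "j < dim_col A"
  shows "A *\<^sub>v unit_vec (dim_col A) j = col A j"
  using assms by (intro eq_vecI) auto

lemma mat_succeq_iff_sq_norm_bound:
  fixes A B :: "'a :: linordered_field mat"
  assumes A: "A \<in> carrier_mat m n" and B: "B \<in> carrier_mat k n"
  shows "mat_succeq n A B \<longleftrightarrow>
    (\<exists>r :: nat. \<forall>v \<in> carrier_vec n.
       (A *\<^sub>v v) \<bullet> (A *\<^sub>v v) \<le> of_nat r * ((B *\<^sub>v v) \<bullet> (B *\<^sub>v v)))"
proof -
  have "v \<bullet> ((of_nat r \<cdot>\<^sub>m (transpose_mat B * B) - transpose_mat A * A) *\<^sub>v v)
      = of_nat r * ((B *\<^sub>v v) \<bullet> (B *\<^sub>v v)) - (A *\<^sub>v v) \<bullet> (A *\<^sub>v v)"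
    if v: "v \<in> carrier_vec n" for v and r :: nat
  proof -
    have "(of_nat r \<cdot>\<^sub>m (transpose_mat B * B) - transpose_mat A * A) *\<^sub>v v
        = of_nat r \<cdot>\<^sub>v ((transpose_mat B * B) *\<^sub>v v) - (transpose_mat A * A) *\<^sub>v v"
      using A B v
      by (subst minus_mult_distrib_mat_vec[of _ n n])
         (auto simp: smult_mat_mult_vec)
    then show ?thesis
      using A B v gram_quadratic_form[OF A v] gram_quadratic_form[OF B v]
      by (simp add: scalar_prod_minus_distrib[of _ n])
  qed
  then show ?thesis
    unfolding mat_succeq_def psd_le_def psd_def by simp
qed

lemma mat_sim_refl: "A \<in> mats n \<Longrightarrow> mat_sim n A A"
  unfolding mat_sim_def mats_def
  by (auto simp: mat_succeq_iff_sq_norm_bound intro!: exI[of _ 1])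

section \<open>Pivots of an echelon form\<close>

definition pivot_at :: "'a :: zero mat \<Rightarrow> nat \<Rightarrow> nat \<Rightarrow> bool" where
  "pivot_at C i j \<longleftrightarrow> nonzero_row C i \<and> pivot_col C i = j"

lemma pivot_at_bounds:
  assumes "pivot_at C i j"
  shows "i < dim_row C" "j < dim_col C" "C $$ (i, j) \<noteq> 0"
proof -
  from assms obtain l where "l < dim_col C \<and> C $$ (i, l) \<noteq> 0" and "i < dim_row C"
    and j: "j = (LEAST l. l < dim_col C \<and> C $$ (i, l) \<noteq> 0)"
    unfolding pivot_at_def nonzero_row_def pivot_col_def by auto
  then show "i < dim_row C" "j < dim_col C" "C $$ (i, j) \<noteq> 0"
    using LeastI[of "\<lambda>l. l < dim_col C \<and> C $$ (i, l) \<noteq> 0" l] by auto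
qed

lemma zero_left_of_pivot:
  assumes "pivot_at C i j" and "l < j"
  shows "C $$ (i, l) = 0"
proof -
  have "l < dim_col C"
    using pivot_at_bounds[OF assms(1)] assms(2) by simp
  then show ?thesis
    using assms not_less_Least unfolding pivot_at_def pivot_col_def by blast
qed

lemma nonzero_entry_right_of_pivot:
  assumes "C $$ (i, l) \<noteq> 0" and "i < dim_row C" and "l < dim_col C"
  obtains j where "pivot_at C i j" and "j \<le> l"
proof
  show "pivot_at C i (pivot_col C i)"
    using assms unfolding pivot_at_def nonzero_row_def by auto
  show "pivot_col C i \<le> l"
    unfolding pivot_col_def using assms by (simp add: Least_le)
qed

lemma pivot_at_strict_mono:
  assumes C: "echelon_form C" and i': "pivot_at C i' j'" and i: "pivot_at C i j" and "i < i'"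
  shows "j < j'"
proof -
  have "pivot_col C i < pivot_col C i'"
    using \<open>i < i'\<close> i'[unfolded pivot_at_def, THEN conjunct1]
  proof (induction i' rule: less_Suc_induct[consumes 1])
    case (1 i)
    then show ?case
      using C unfolding echelon_form_def by blast
  next
    case (2 i k l)
    then show ?case
      using C unfolding echelon_form_def by (meson less_trans)
  qed
  then show ?thesis
    using i i' by (simp add: pivot_at_def)
qed

lemma pivot_at_unique_row:
  "echelon_form C \<Longrightarrow> pivot_at C i j \<Longrightarrow> pivot_at C i' j \<Longrightarrow> i = i'"
  by (metis pivot_at_strict_mono less_irrefl linorder_neqE_nat)

lemma zero_below_pivot:
  assumes C: "echelon_form C" and i: "pivot_at C i j" and "i < i'" and "i' < dim_row C"
  shows "C $$ (i', j) = 0"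
proof (rule ccontr)
  assume "C $$ (i', j) \<noteq> 0"
  then obtain j' where "pivot_at C i' j'" and "j' \<le> j"
    using nonzero_entry_right_of_pivot pivot_at_bounds(2)[OF i] \<open>i' < dim_row C\<close> by metis
  then show False
    using pivot_at_strict_mono[OF C _ i \<open>i < i'\<close>] by fastforce
qed

text \<open>
  A row is determined by the rank of its pivot column among all the pivot columns, so the set
  of pivot columns fixes which columns belong to which row.
\<close>

lemma pivot_at_determined_by_columns:
  assumes A: "echelon_form A" and B: "echelon_form B"
    and cols: "\<And>j. (\<exists>i. pivot_at A i j) \<longleftrightarrow> (\<exists>i. pivot_at B i j)"
  shows "pivot_at A i j \<Longrightarrow> pivot_at B i j"
proof (induction i arbitrary: j rule: less_induct)
  case (less i)
  obtain i' where i': "pivot_at B i' j"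
    using less.prems cols by blast
  have "\<not> i' < i"
  proof
    assume "i' < i"
    then obtain l where l: "pivot_at A i' l"
      using A less.prems unfolding echelon_form_def pivot_at_def by blast
    have "pivot_at B i' l"
      using less.IH \<open>i' < i\<close> l by blast
    then show False
      using i' pivot_at_strict_mono[OF A less.prems l \<open>i' < i\<close>] by (simp add: pivot_at_def)
  qed
  moreover have "\<not> i < i'"
  proof
    assume "i < i'"
    then obtain l where l: "pivot_at B i l"
      using B i' unfolding echelon_form_def pivot_at_def by blast
    have "l < j"
      using pivot_at_strict_mono[OF B i' l \<open>i < i'\<close>] .
    obtain k where k: "pivot_at A k l"
      using l cols by blast
    have "k < i"
      using pivot_at_strict_mono[OF A k less.prems] \<open>l < j\<close> k less.prems
      by (metis linorder_neqE_nat not_less_iff_gr_or_eq pivot_at_def)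
    then show False
      using less.IH[OF _ k] pivot_at_unique_row[OF B l] by blast
  qed
  ultimately show ?case
    using i' by (metis linorder_neqE_nat)
qed

lemma shape_eq_right_of_pivots:
  "shape C = {(i, j). j < dim_col C \<and> (\<exists>l \<le> j. pivot_at C i l)}"
proof -
  have "i < dim_row C \<and> (\<exists>l \<le> j. C $$ (i, l) \<noteq> 0) \<longleftrightarrow> (\<exists>l \<le> j. pivot_at C i l)"
    if "j < dim_col C" for i j
  proof (intro iffI; elim conjE exE)
    fix l assume "i < dim_row C" and l: "l \<le> j" "C $$ (i, l) \<noteq> 0"
    then obtain k where "pivot_at C i k" "k \<le> l"
      using nonzero_entry_right_of_pivot[of C i l] \<open>j < dim_col C\<close> by auto
    then show "\<exists>l \<le> j. pivot_at C i l"
      using l by (auto intro: le_trans)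
  next
    fix l assume "l \<le> j" "pivot_at C i l"
    then show "i < dim_row C \<and> (\<exists>l \<le> j. C $$ (i, l) \<noteq> 0)"
      using pivot_at_bounds[of C i l] by auto
  qed
  then show ?thesis
    unfolding shape_def by blast
qed

section \<open>Squared pivots as minima\<close>

definition monic_vecs :: "nat \<Rightarrow> nat \<Rightarrow> 'a :: {zero, one} vec set" where
  "monic_vecs n j = {v \<in> carrier_vec n. v $ j = 1 \<and> (\<forall>l < n. j < l \<longrightarrow> v $ l = 0)}"

text \<open>
  An echelon form has at most one pivot in column \<open>j\<close>, so this is its square, or 0 if there is
  none. The sum makes both cases uniform.
\<close>

definition column_pivot_sq :: "'a :: linordered_field mat \<Rightarrow> nat \<Rightarrow> 'a" where
  "column_pivot_sq C j =
     (\<Sum>i = 0..<dim_row C. if pivot_at C i j then (C $$ (i, j))\<^sup>2 else 0)"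

lemma column_pivot_sq_pivot:
  assumes C: "echelon_form C" and i: "pivot_at C i j"
  shows "column_pivot_sq C j = (C $$ (i, j))\<^sup>2"
proof -
  have "pivot_at C i' j \<longleftrightarrow> i' = i" for i'
    using i pivot_at_unique_row[OF C] by blast
  then show ?thesis
    using pivot_at_bounds(1)[OF i] by (simp add: column_pivot_sq_def)
qed

lemma column_pivot_sq_eq_0_iff:
  "column_pivot_sq C j = 0 \<longleftrightarrow> \<not> (\<exists>i. pivot_at C i j)"
  unfolding column_pivot_sq_def
  using pivot_at_bounds[of C _ j] by (subst sum_nonneg_eq_0_iff) auto

lemma mult_mat_vec_entry:
  assumes "v \<in> carrier_vec (dim_col C)" and "i < dim_row C"
  shows "(C *\<^sub>v v) $ i = (\<Sum>l = 0..<dim_col C. C $$ (i, l) * v $ l)"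
  using assms by (simp add: scalar_prod_def)

text \<open>
  In a row with pivot in column \<open>j\<close> all entries to the left are 0, and \<open>v\<close> has only
  zeros to the right, so this row of \<open>C v\<close> is exactly the pivot.
\<close>

lemma column_pivot_sq_le:
  fixes C :: "'a :: linordered_field mat"
  assumes v: "v \<in> monic_vecs (dim_col C) j"
  shows "column_pivot_sq C j \<le> (C *\<^sub>v v) \<bullet> (C *\<^sub>v v)"
proof -
  have entry: "(C *\<^sub>v v) $ i = C $$ (i, j)" if i: "pivot_at C i j" for i
  proof -
    have "(C *\<^sub>v v) $ i = (\<Sum>l = 0..<dim_col C. C $$ (i, l) * v $ l)"
      using v pivot_at_bounds[OF i] by (intro mult_mat_vec_entry) (auto simp: monic_vecs_def)
    also have "\<dots> = (\<Sum>l = 0..<dim_col C. if l = j then C $$ (i, j) else 0)"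
      using v zero_left_of_pivot[OF i]
      by (intro sum.cong) (auto simp: monic_vecs_def neq_iff)
    finally show ?thesis
      using pivot_at_bounds[OF i] by simp
  qed
  have "column_pivot_sq C j \<le> (\<Sum>i = 0..<dim_row C. ((C *\<^sub>v v) $ i)\<^sup>2)"
    unfolding column_pivot_sq_def by (intro sum_mono) (auto simp: entry simp del: index_mult_mat_vec)
  then show ?thesis
    by (simp add: scalar_prod_def power2_eq_square)
qed

text \<open>
  Back substitution: clearing the last nonzero entry of \<open>w\<close> by means of the pivot of its row
  changes only entries above it, since the pivot column vanishes below the pivot. The bound
  \<open>k\<close> on the rows where \<open>w\<close> is nonzero drives the induction.
\<close>

lemma back_substitution:
  fixes C :: "'a :: field mat"
  assumes C: "echelon_form C"
  shows "\<lbrakk>w \<in> carrier_vec (dim_row C); k \<le> dim_row C;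
      \<And>i. i < dim_row C \<Longrightarrow> w $ i \<noteq> 0 \<Longrightarrow> i < k \<and> (\<exists>l < j. pivot_at C i l)\<rbrakk>
    \<Longrightarrow> \<exists>x \<in> carrier_vec (dim_col C). C *\<^sub>v x = w \<and> (\<forall>l < dim_col C. j \<le> l \<longrightarrow> x $ l = 0)"
proof (induction k arbitrary: w)
  case 0
  then have "w = 0\<^sub>v (dim_row C)"
    by (intro eq_vecI) auto
  then show ?case
    by (intro bexI[of _ "0\<^sub>v (dim_col C)"]) auto
next
  case (Suc k)
  show ?case
  proof (cases "w $ k = 0")
    case True
    show ?thesis
    proof (rule Suc.IH)
      fix i assume "i < dim_row C" "w $ i \<noteq> 0"
      then show "i < k \<and> (\<exists>l < j. pivot_at C i l)"
        using Suc.prems(3)[of i] True by (auto simp: less_Suc_eq)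
    qed (use Suc.prems in auto)
  next
    case False
    then obtain c where c: "c < j" "pivot_at C k c"
      using Suc.prems by (metis Suc_le_lessD)
    note cb = pivot_at_bounds[OF c(2)]
    define a where "a = w $ k / C $$ (k, c)"
    define w' where "w' = w - a \<cdot>\<^sub>v col C c"
    have w': "w' \<in> carrier_vec (dim_row C)"
      by (simp add: w'_def carrier_vecI)
    have w'_i: "w' $ i = w $ i - a * C $$ (i, c)" if "i < dim_row C" for i
      using that cb Suc.prems(1) by (simp add: w'_def)
    have "\<exists>x \<in> carrier_vec (dim_col C). C *\<^sub>v x = w' \<and> (\<forall>l < dim_col C. j \<le> l \<longrightarrow> x $ l = 0)"
    proof (rule Suc.IH[OF w'])
      fix i assume i: "i < dim_row C" "w' $ i \<noteq> 0"
      have "i \<noteq> k"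
        using i w'_i[of i] cb by (auto simp: a_def)
      moreover have "\<not> k < i"
        using i w'_i[of i] zero_below_pivot[OF C c(2)] Suc.prems(3)[of i] by auto
      ultimately have "i < k"
        by simp
      then obtain l where l: "pivot_at C i l"
        using C c(2) unfolding echelon_form_def pivot_at_def by blast
      then have "l < j"
        using pivot_at_strict_mono[OF C c(2) l \<open>i < k\<close>] \<open>c < j\<close> by simp
      with l \<open>i < k\<close> show "i < k \<and> (\<exists>l < j. pivot_at C i l)"
        by blast
    qed (use Suc.prems in auto)
    then obtain x where x: "x \<in> carrier_vec (dim_col C)" "C *\<^sub>v x = w'"
      "\<forall>l < dim_col C. j \<le> l \<longrightarrow> x $ l = 0"
      by blast
    define y where "y = x + a \<cdot>\<^sub>v unit_vec (dim_col C) c"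
    have "C *\<^sub>v y = w' + a \<cdot>\<^sub>v col C c"
      unfolding y_def using x cb
      by (simp add: mult_add_distrib_mat_vec[of _ "dim_row C" "dim_col C"]
          mult_mat_vec[of _ "dim_row C" "dim_col C"] mult_mat_unit_vec)
    also have "\<dots> = w"
      using Suc.prems(1) by (auto simp: w'_def)
    finally have "C *\<^sub>v y = w" .
    moreover have "y \<in> carrier_vec (dim_col C)"
      using x by (simp add: y_def)
    moreover have "\<forall>l < dim_col C. j \<le> l \<longrightarrow> y $ l = 0"
      using x c by (auto simp: y_def)
    ultimately show ?thesis
      by blast
  qed
qed

lemma column_pivot_sq_attained:
  fixes C :: "'a :: linordered_field mat"
  assumes C: "echelon_form C" and j: "j < dim_col C"
  obtains v where "v \<in> monic_vecs (dim_col C) j"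
    and "(C *\<^sub>v v) \<bullet> (C *\<^sub>v v) = column_pivot_sq C j"
proof -
  \<comment> \<open>The part of column \<open>j\<close> to cancel: it lies in the rows with a pivot further left. In
    all other rows column \<open>j\<close> holds a pivot or 0.\<close>
  define w where "w = vec (dim_row C) (\<lambda>i. if \<exists>l < j. pivot_at C i l then - C $$ (i, j) else 0)"
  have "\<exists>x \<in> carrier_vec (dim_col C). C *\<^sub>v x = w \<and> (\<forall>l < dim_col C. j \<le> l \<longrightarrow> x $ l = 0)"
    by (rule back_substitution[OF C, where k = "dim_row C"]) (auto simp: w_def split: if_splits)
  then obtain x where x: "x \<in> carrier_vec (dim_col C)" "C *\<^sub>v x = w"
    "\<forall>l < dim_col C. j \<le> l \<longrightarrow> x $ l = 0"
    by blast
  define v where "v = x + unit_vec (dim_col C) j"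
  have Cv: "C *\<^sub>v v = w + col C j"
    unfolding v_def using x j
    by (simp add: mult_add_distrib_mat_vec[of _ "dim_row C" "dim_col C"]
        mult_mat_unit_vec)
  have entry: "(C *\<^sub>v v) $ i = (if pivot_at C i j then C $$ (i, j) else 0)"
    if i: "i < dim_row C" for i
  proof (cases "C $$ (i, j) = 0")
    case True
    then show ?thesis
      using i j by (simp add: Cv w_def)
  next
    case False
    then obtain l where l: "pivot_at C i l" "l \<le> j"
      using nonzero_entry_right_of_pivot i j by metis
    then have "pivot_at C i l' \<longleftrightarrow> l' = l" for l'
      by (auto simp: pivot_at_def)
    then show ?thesis
      using i j l by (auto simp: Cv w_def)
  qed
  have "(C *\<^sub>v v) \<bullet> (C *\<^sub>v v) = (\<Sum>i = 0..<dim_row C. ((C *\<^sub>v v) $ i)\<^sup>2)"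
    by (simp add: scalar_prod_def power2_eq_square)
  also have "\<dots> = column_pivot_sq C j"
    unfolding column_pivot_sq_def by (intro sum.cong) (auto simp: entry simp del: index_mult_mat_vec)
  finally have "(C *\<^sub>v v) \<bullet> (C *\<^sub>v v) = column_pivot_sq C j" .
  moreover have "v \<in> monic_vecs (dim_col C) j"
    using x j by (auto simp: v_def monic_vecs_def)
  ultimately show thesis
    using that by blast
qed

text \<open>
  A vector at which \<open>\<parallel>B v\<parallel>\<^sup>2\<close> is minimal gives, through the bound on \<open>\<parallel>A v\<parallel>\<^sup>2\<close>, an upper
  bound for the minimum belonging to \<open>A\<close>. The same \<open>r\<close> serves all columns.
\<close>

lemma column_pivot_sq_bound:
  fixes A B :: "'a :: linordered_field mat"
  assumes A: "A \<in> carrier_mat m n" and B: "B \<in> carrier_mat k n"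
    and "echelon_form B" and "mat_succeq n A B"
  obtains r :: nat
  where "\<And>j. j < n \<Longrightarrow> column_pivot_sq A j \<le> of_nat r * column_pivot_sq B j"
proof -
  obtain r :: nat where r: "\<And>v. v \<in> carrier_vec n \<Longrightarrow>
      (A *\<^sub>v v) \<bullet> (A *\<^sub>v v) \<le> of_nat r * ((B *\<^sub>v v) \<bullet> (B *\<^sub>v v))"
    using \<open>mat_succeq n A B\<close> mat_succeq_iff_sq_norm_bound[OF A B] by blast
  have "column_pivot_sq A j \<le> of_nat r * column_pivot_sq B j" if "j < n" for j
  proof -
    have "j < dim_col B"
      using that B by simp
    then obtain v where "v \<in> monic_vecs (dim_col B) j"
      and Bv: "(B *\<^sub>v v) \<bullet> (B *\<^sub>v v) = column_pivot_sq B j"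
      using column_pivot_sq_attained[OF \<open>echelon_form B\<close>] by blast
    then have v: "v \<in> monic_vecs n j"
      using B by simp
    have "column_pivot_sq A j \<le> (A *\<^sub>v v) \<bullet> (A *\<^sub>v v)"
      using column_pivot_sq_le[of v A j] A v by auto
    also have "\<dots> \<le> of_nat r * column_pivot_sq B j"
      using r[of v] v by (simp add: monic_vecs_def Bv)
    finally show ?thesis .
  qed
  then show thesis
    using that by blast
qed

lemma pivot_column_transfer:
  fixes A B :: "'a :: linordered_field mat"
  assumes A: "A \<in> carrier_mat m n" and B: "B \<in> carrier_mat k n"
    and "echelon_form B" and "mat_succeq n A B" and i: "pivot_at A i j"
  shows "\<exists>i'. pivot_at B i' j"
proof -
  obtain r :: nat where r: "column_pivot_sq A j \<le> of_nat r * column_pivot_sq B j"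
    using column_pivot_sq_bound[OF assms(1-4)] pivot_at_bounds(2)[OF i] A by (metis carrier_matD(2))
  have "column_pivot_sq A j \<ge> 0"
    by (simp add: column_pivot_sq_def sum_nonneg)
  moreover have "column_pivot_sq A j \<noteq> 0"
    using i column_pivot_sq_eq_0_iff by blast
  ultimately have "column_pivot_sq B j \<noteq> 0"
    using r by auto
  then show ?thesis
    using column_pivot_sq_eq_0_iff by blast
qed

section \<open>The natural valuation\<close>

lemma nat_succeq_trans:
  assumes "nat_succeq a b" and "nat_succeq b c"
  shows "nat_succeq a c"
proof -
  obtain r s :: nat where r: "\<bar>a\<bar> \<le> of_nat r * \<bar>b\<bar>" and s: "\<bar>b\<bar> \<le> of_nat s * \<bar>c\<bar>"
    using assms unfolding nat_succeq_def by blast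
  have "\<bar>a\<bar> \<le> of_nat r * (of_nat s * \<bar>c\<bar>)"
    using r mult_left_mono[OF s, of "of_nat r"] by simp
  then show ?thesis
    unfolding nat_succeq_def by (intro exI[of _ "r * s"]) (simp add: mult.assoc)
qed

lemma natural_val_eqI: "nat_succeq a b \<Longrightarrow> nat_succeq b a \<Longrightarrow> natural_val a = natural_val b"
  unfolding natural_val_def nat_sim_def using nat_succeq_trans by blast

text \<open>The natural factor survives taking square roots because \<open>r \<le> r\<^sup>2\<close>.\<close>

lemma nat_succeq_of_sq_le:
  assumes "a\<^sup>2 \<le> of_nat r * b\<^sup>2"
  shows "nat_succeq a b"
proof -
  have "of_nat r \<le> (of_nat r * of_nat r :: 'a)"
    using of_nat_mono[OF le_square[of r], where 'a = 'a] by simp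
  then have "of_nat r * b\<^sup>2 \<le> (of_nat r * b)\<^sup>2"
    by (simp add: power_mult_distrib power2_eq_square[of "of_nat r"] mult_right_mono)
  then have "\<bar>a\<bar> \<le> \<bar>of_nat r * b\<bar>"
    using assms by (simp add: abs_le_square_iff)
  then show ?thesis
    unfolding nat_succeq_def by (auto simp: abs_mult)
qed

lemma pivot_nat_succeq:
  fixes A B :: "'a :: linordered_field mat"
  assumes A: "A \<in> carrier_mat m n" and B: "B \<in> carrier_mat k n"
    and "echelon_form A" and "echelon_form B" and "mat_succeq n A B"
    and i: "pivot_at A i j" and i': "pivot_at B i' j"
  shows "nat_succeq (A $$ (i, j)) (B $$ (i', j))"
proof -
  obtain r :: nat where "column_pivot_sq A j \<le> of_nat r * column_pivot_sq B j"
    using column_pivot_sq_bound[OF A B assms(4,5)] pivot_at_bounds(2)[OF i] A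
    by (metis carrier_matD(2))
  then show ?thesis
    using nat_succeq_of_sq_le column_pivot_sq_pivot[OF _ i] column_pivot_sq_pivot[OF _ i'] assms
    by metis
qed

section \<open>The value of an echelon form determines its shape and the values of its pivots\<close>

theorem corollary3p4:
  fixes A B :: "'a :: linordered_field mat" and n :: nat
  assumes "n \<ge> 1"
    and "A \<in> mats n" and "B \<in> mats n"
    and "echelon_form A" and "echelon_form B"
    and "mat_val n A = mat_val n B"
  shows "shape A = shape B \<and>
    (\<forall>i. nonzero_row A i \<longrightarrow> natural_val (pivot A i) = natural_val (pivot B i))"
proof -
  obtain m k where A: "A \<in> carrier_mat m n" and B: "B \<in> carrier_mat k n"
    using assms(2,3) unfolding mats_def by blast
  have "B \<in> mat_val n A"
    using assms(3,6) mat_sim_refl unfolding mat_val_def by blast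
  then have AB: "mat_succeq n A B" and BA: "mat_succeq n B A"
    by (auto simp: mat_val_def mat_sim_def)
  have cols: "(\<exists>i. pivot_at A i j) \<longleftrightarrow> (\<exists>i. pivot_at B i j)" for j
    using pivot_column_transfer[OF A B assms(5) AB] pivot_column_transfer[OF B A assms(4) BA]
    by blast
  have same: "pivot_at A i j \<longleftrightarrow> pivot_at B i j" for i j
    using pivot_at_determined_by_columns[OF assms(4,5) cols]
      pivot_at_determined_by_columns[OF assms(5,4) cols[symmetric]] by blast
  have "shape A = shape B"
    using A B by (simp add: shape_eq_right_of_pivots same)
  moreover have "natural_val (pivot A i) = natural_val (pivot B i)" if "nonzero_row A i" for i
  proof -
    define j where "j = pivot_col A i"
    have a: "pivot_at A i j"
      using that by (simp add: pivot_at_def j_def)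
    then have b: "pivot_at B i j"
      by (simp add: same)
    have "natural_val (A $$ (i, j)) = natural_val (B $$ (i, j))"
      using pivot_nat_succeq[OF A B assms(4,5) AB a b] pivot_nat_succeq[OF B A assms(5,4) BA b a]
      by (rule natural_val_eqI)
    then show ?thesis
      using a b by (simp add: pivot_def pivot_at_def)
  qed
  ultimately show ?thesis
    by blast
qed

end
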